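(* If $\beta>\beta_c$, then $\boldsymbol P$-almost surely $$\nu^{ext}(u,\infty)\sim\bar\varepsilon\,u^{-\alpha}\alpha\,\Gamma(\alpha)\qquad\text{as }u\to0^+.$$
   Context: Set $\beta_c=\sqrt{2\log 2}$ and $\alpha=\beta_c/\beta$, and let $0<\bar\varepsilon<\infty$ be a constant. On a probability space $(\Omega,\mathcal F,\boldsymbol P)$ let $\{\gamma_k\}_{k\ge1}$ be the marks (points) of a Poisson random measure on $(0,\infty)$ with mean measure $\mu$ given by $\mu(x,\infty)=x^{-\alpha}$, $x>0$. The random measure $\nu^{ext}$ on $(0,\infty)$ is defined by $\nu^{ext}(u,\infty)=\bar\varepsilon\sum_{k=1}^\infty e^{-u/\gamma_k}$, $u>0$. Here $\Gamma$ is the Gamma function and $f\sim g$ means $f/g\to1$. *)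

theory Defs
  imports "HOL-Probability.Probability" "HOL-Library.Landau_Symbols"
begin

definition beta_c :: real where
  "beta_c = sqrt (2 * ln 2)"

text \<open>The Borel space on $(0,\infty)$. The trace of $(u,\infty)$ on it is \<open>{u<..}\<close> for $u \ge 0$.\<close>

definition pos_borel :: "real measure" where
  "pos_borel = restrict_space borel {0<..}"

text \<open>Random measures may take the value $\infty$; the Giry monad in the library only covers
  (sub-)probability kernels.\<close>

definition random_measure :: "'a measure \<Rightarrow> 'b measure \<Rightarrow> ('a \<Rightarrow> 'b measure) \<Rightarrow> bool" where
  "random_measure P S N \<longleftrightarrow>
     (\<forall>\<omega>\<in>space P. sets (N \<omega>) = sets S) \<and>
     (\<forall>A\<in>sets S. (\<lambda>\<omega>. emeasure (N \<omega>) A) \<in> borel_measurable P)"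

text \<open>Poisson random measure with mean measure \<open>\<mu>\<close>. A Poisson variable of infinite mean is,
  as usual, almost surely infinite. The Poisson weights are written out because \<open>poisson_pmf\<close> is
  only specified for positive rates, while null sets of \<open>\<mu>\<close> need rate 0.\<close>

definition poisson_random_measure :: "'a measure \<Rightarrow> 'b measure \<Rightarrow> ('a \<Rightarrow> 'b measure) \<Rightarrow> bool" where
  "poisson_random_measure P \<mu> N \<longleftrightarrow>
     random_measure P \<mu> N \<and>
     (\<forall>A\<in>sets \<mu>. emeasure \<mu> A < \<infinity> \<longrightarrow>
        (\<forall>n. measure P {\<omega>\<in>space P. emeasure (N \<omega>) A = of_nat n} =
             measure \<mu> A ^ n / fact n * exp (- measure \<mu> A))) \<and>
     (\<forall>A\<in>sets \<mu>. emeasure \<mu> A = \<infinity> \<longrightarrow> (AE \<omega> in P. emeasure (N \<omega>) A = \<infinity>)) \<and>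
     (\<forall>(A :: nat \<Rightarrow> 'b set) I. finite I \<longrightarrow> A ` I \<subseteq> sets \<mu> \<longrightarrow> disjoint_family_on A I \<longrightarrow>
        prob_space.indep_vars P (\<lambda>_. borel) (\<lambda>i \<omega>. emeasure (N \<omega>) (A i)) I)"

text \<open>The point measure $\sum_k \delta_{x_k}$ on \<open>S\<close>; repeated points count with multiplicity,
  and \<open>A\<close> has mass $\infty$ if it contains infinitely many of the $x_k$.\<close>

definition point_process :: "'b measure \<Rightarrow> (nat \<Rightarrow> 'b) \<Rightarrow> 'b measure" where
  "point_process S x = distr (count_space UNIV) S x"

end

theory Submission imports Defs "HOL-Real_Asymp.Real_Asymp" begin

text \<open>The number of marks above \<open>x\<close> is Poisson of rate \<open>x powr (- \<alpha>)\<close> and decreasing in \<open>x\<close>.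
  Chebyshev and Borel-Cantelli along the rates $n^2$, with monotonicity in between, show that almost
  surely it is asymptotic to its mean as $x \to 0$. Since
  \<open>exp (- u / x k)\<close> is the integral of \<open>exp (- s)\<close> over \<open>s \<ge> u / x k\<close>, the sum is the integral of
  \<open>exp (- s)\<close> times the number of marks above \<open>u / s\<close>, and dominated convergence gives the limit
  \<open>Gamma (\<alpha> + 1)\<close> after multiplication by \<open>u powr \<alpha>\<close>.\<close>

section \<open>Poisson weights: variance and Chebyshev's inequality\<close>

text \<open>Expand \<open>(n - l)^2 = n * (n - 1) + (1 - 2 * l) * n + l^2\<close>. The first two
  factorial moments reduce to the exponential series by index shifts, because the factors
  \<open>n\<close> and \<open>n - 1\<close> cancel against the factorial.\<close>

lemma poisson_weights_variance_sums:
  fixes l :: real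
  shows "(\<lambda>n. (real n - l)^2 * (l ^ n / fact n * exp (- l))) sums l"
proof -
  have e: "(\<lambda>n. l ^ n / fact n) sums exp l"
    using exp_converges[of l] by (simp add: divide_inverse_commute)
  have shift: "real (Suc n) * (l ^ Suc n / fact (Suc n)) = l * (l ^ n / fact n)" for n
    by (simp add: field_simps del: of_nat_Suc)
  have m1: "(\<lambda>n. real n * (l ^ n / fact n)) sums (l * exp l)"
    by (rule sums_Suc_imp) (simp, unfold shift, rule sums_mult[OF e])
  have shift2: "real (Suc n) * (real (Suc n) - 1) * (l ^ Suc n / fact (Suc n))
      = l * (real n * (l ^ n / fact n))" for n
    by (simp add: field_simps del: of_nat_Suc) (simp add: field_simps)
  have m2: "(\<lambda>n. real n * (real n - 1) * (l ^ n / fact n)) sums (l * (l * exp l))"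
    by (rule sums_Suc_imp) (simp, unfold shift2, rule sums_mult[OF m1])
  have "(\<lambda>n. exp (- l) * (real n * (real n - 1) * (l ^ n / fact n)
          + ((1 - 2 * l) * (real n * (l ^ n / fact n)) + l^2 * (l ^ n / fact n)))) sums
        (exp (- l) * (l * (l * exp l) + ((1 - 2 * l) * (l * exp l) + l^2 * exp l)))"
    by (intro sums_mult sums_add m1 m2 e)
  moreover have "exp (- l) * (l * (l * exp l) + ((1 - 2 * l) * (l * exp l) + l^2 * exp l)) = l"
    by (simp add: exp_minus field_simps power2_eq_square)
  moreover have "exp (- l) * (real n * (real n - 1) * (l ^ n / fact n)
          + ((1 - 2 * l) * (real n * (l ^ n / fact n)) + l^2 * (l ^ n / fact n)))
      = (real n - l)^2 * (l ^ n / fact n * exp (- l))" for n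
    by (simp add: field_simps power2_eq_square)
  ultimately show ?thesis by simp
qed

context prob_space
begin

text \<open>The weights sum to \<open>exp l * exp (- l) = 1\<close>, so the disjoint events
  \<open>A n\<close> exhaust the space up to a null set. In particular \<open>X\<close> is almost
  surely finite, so \<open>enn2real\<close> loses nothing.\<close>

lemma poisson_AE_nat:
  fixes X :: "'a \<Rightarrow> ennreal"
  assumes [measurable]: "X \<in> borel_measurable M"
    and X: "\<And>n. prob {\<omega>\<in>space M. X \<omega> = of_nat n} = l ^ n / fact n * exp (- l)"
  shows "AE \<omega> in M. \<exists>n. X \<omega> = of_nat n"
proof -
  define A where "A n = {\<omega>\<in>space M. X \<omega> = of_nat n}" for n
  have "(\<lambda>n. prob (A n)) sums prob (\<Union>n. A n)"
    by (rule finite_measure_UNION) (auto simp: A_def disjoint_family_on_def)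
  moreover have "(\<lambda>n. prob (A n)) sums (exp l * exp (- l))"
    unfolding A_def X using exp_converges[of l]
    by (intro sums_mult2) (simp add: divide_inverse_commute)
  ultimately have "prob (\<Union>n. A n) = 1"
    by (simp add: sums_iff exp_minus)
  from AE_prob_1[OF this] show ?thesis
    by eventually_elim (auto simp: A_def)
qed

text \<open>The law is known only through its point masses, so the event is cut into the atoms
  \<open>A n\<close>. On an atom that meets it, \<open>(n - l)^2 / d^2\<close> is at least 1, and
  summing the weighted bound gives the variance over \<open>d^2\<close>.\<close>

lemma poisson_chebyshev:
  fixes X :: "'a \<Rightarrow> ennreal"
  assumes [measurable]: "X \<in> borel_measurable M"
    and X: "\<And>n. prob {\<omega>\<in>space M. X \<omega> = of_nat n} = l ^ n / fact n * exp (- l)"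
    and "0 < l" "0 < d"
  shows "prob {\<omega>\<in>space M. d \<le> \<bar>enn2real (X \<omega>) - l\<bar>} \<le> l / d\<^sup>2"
proof -
  define A where "A n = {\<omega>\<in>space M. X \<omega> = of_nat n \<and> d \<le> \<bar>real n - l\<bar>}" for n
  have [measurable]: "A n \<in> events" for n unfolding A_def by measurable
  have "prob {\<omega>\<in>space M. d \<le> \<bar>enn2real (X \<omega>) - l\<bar>} \<le> prob (\<Union>n. A n)"
  proof (rule finite_measure_mono_AE)
    show "AE \<omega> in M. \<omega> \<in> {\<omega>\<in>space M. d \<le> \<bar>enn2real (X \<omega>) - l\<bar>} \<longrightarrow> \<omega> \<in> (\<Union>n. A n)"
      using poisson_AE_nat[OF assms(1) X] by eventually_elim (auto simp: A_def)
  qed auto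
  also have "\<dots> \<le> l / d\<^sup>2"
  proof (rule sums_le)
    show "(\<lambda>n. prob (A n)) sums prob (\<Union>n. A n)"
      by (rule finite_measure_UNION) (auto simp: disjoint_family_on_def A_def)
    show "(\<lambda>n. (real n - l)^2 * (l ^ n / fact n * exp (- l)) / d\<^sup>2) sums (l / d\<^sup>2)"
      by (rule sums_divide[OF poisson_weights_variance_sums])
    show "prob (A n) \<le> (real n - l)^2 * (l ^ n / fact n * exp (- l)) / d\<^sup>2" for n
    proof (cases "d \<le> \<bar>real n - l\<bar>")
      case True
      then have "d\<^sup>2 \<le> (real n - l)\<^sup>2"
        using \<open>0 < d\<close> by (metis abs_of_pos abs_le_square_iff)
      then have "1 \<le> (real n - l)\<^sup>2 / d\<^sup>2" using \<open>0 < d\<close> by (simp add: field_simps)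
      then have "1 * (l ^ n / fact n * exp (- l))
          \<le> (real n - l)\<^sup>2 / d\<^sup>2 * (l ^ n / fact n * exp (- l))"
        using \<open>0 < l\<close> by (intro mult_right_mono) auto
      with True show ?thesis using X[of n] by (simp add: A_def mult.commute)
    next
      case False
      then show ?thesis using \<open>0 < l\<close> by (simp add: A_def)
    qed
  qed
  finally show ?thesis .
qed

end

section \<open>Strong law for a monotone Poisson family\<close>

text \<open>Every large \<open>l\<close> lies between consecutive squares, and the ratio of
  consecutive squares tends to 1, so monotonicity interpolates without loss in the limit.\<close>

lemma mono_ratio_tendsto_of_squares:
  fixes F :: "real \<Rightarrow> real"
  assumes mono: "\<And>l m. 0 < l \<Longrightarrow> l \<le> m \<Longrightarrow> F l \<le> F m"
    and nonneg: "\<And>l. 0 \<le> F l"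
    and lim: "(\<lambda>n. F ((real n)\<^sup>2) / (real n)\<^sup>2) \<longlonglongrightarrow> 1"
  shows "((\<lambda>l. F l / l) \<longlongrightarrow> 1) at_top"
proof -
  \<comment> \<open>For \<open>m\<close> at least 1 these are \<open>F (m^2) / (m + 1)^2\<close> and
    \<open>F ((m + 1)^2) / m^2\<close>, factored so that each factor has a known limit.\<close>
  define lo where "lo m = F ((real m)\<^sup>2) / (real m)\<^sup>2 * (real m / real (Suc m))\<^sup>2" for m
  define up where "up m = F ((real (Suc m))\<^sup>2) / (real (Suc m))\<^sup>2 * (real (Suc m) / real m)\<^sup>2" for m
  have "lo \<longlonglongrightarrow> 1 * 1\<^sup>2" unfolding lo_def
    by (intro tendsto_mult tendsto_power lim LIMSEQ_n_over_Suc_n)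
  moreover have "up \<longlonglongrightarrow> 1 * 1\<^sup>2" unfolding up_def
    by (intro tendsto_mult tendsto_power LIMSEQ_Suc[OF lim] LIMSEQ_Suc_n_over_n)
  moreover have fl: "filterlim (\<lambda>l. nat \<lfloor>sqrt l\<rfloor>) sequentially at_top"
    by (rule filterlim_compose[OF filterlim_nat_sequentially
          filterlim_compose[OF filterlim_floor_sequentially sqrt_at_top]])
  ultimately have lims: "((\<lambda>l. lo (nat \<lfloor>sqrt l\<rfloor>)) \<longlongrightarrow> 1) at_top"
      "((\<lambda>l. up (nat \<lfloor>sqrt l\<rfloor>)) \<longlongrightarrow> 1) at_top"
    by (auto intro: filterlim_compose)
  have "\<forall>\<^sub>F l in at_top. lo (nat \<lfloor>sqrt l\<rfloor>) \<le> F l / l \<and> F l / l \<le> up (nat \<lfloor>sqrt l\<rfloor>)"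
    \<comment> \<open>From \<open>l\<close> at least 1 on, the integer part of \<open>sqrt l\<close>
      is at least 1, so the divisions by \<open>m^2\<close> are genuine.\<close>
    using eventually_ge_at_top[of 1]
  proof eventually_elim
    case (elim l)
    define m where "m = nat \<lfloor>sqrt l\<rfloor>"
    have "1 \<le> sqrt l" using elim by simp
    then have "1 \<le> \<lfloor>sqrt l\<rfloor>" by simp
    then have m: "real m \<le> sqrt l" "sqrt l \<le> real (Suc m)" "1 \<le> real m"
      unfolding m_def by linarith+
    have ml: "(real m)\<^sup>2 \<le> l"
      using power_mono[OF m(1), of 2] elim by simp
    have lm: "l \<le> (real (Suc m))\<^sup>2"
      using power_mono[OF m(2), of 2] elim by simp
    have "lo m = F ((real m)\<^sup>2) / (real (Suc m))\<^sup>2"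
      using m(3) by (simp add: lo_def power_divide)
    also have "\<dots> \<le> F l / l"
      using ml lm elim m(3) by (intro frac_le nonneg mono) auto
    finally have "lo m \<le> F l / l" .
    have "F l / l \<le> F ((real (Suc m))\<^sup>2) / (real m)\<^sup>2"
      using ml lm elim m(3) by (intro frac_le nonneg mono) auto
    also have "\<dots> = up m"
      using m(3) by (simp add: up_def power_divide del: of_nat_Suc)
    finally show ?case using \<open>lo m \<le> F l / l\<close> by (simp add: m_def)
  qed
  then show ?thesis
    by (intro tendsto_sandwich[OF _ _ lims]) (auto elim: eventually_mono)
qed

text \<open>A relative deviation \<open>d\<close> at rate \<open>l\<close> has probability at most
  \<open>1 / (d^2 * l)\<close>. This is summable along squares, which are still dense enough for the
  interpolation above.\<close>

lemma (in prob_space) poisson_mono_family_strong_law: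
  fixes X :: "real \<Rightarrow> 'a \<Rightarrow> ennreal"
  assumes [measurable]: "\<And>l. 0 < l \<Longrightarrow> X l \<in> borel_measurable M"
    and X: "\<And>l n. 0 < l \<Longrightarrow> prob {\<omega>\<in>space M. X l \<omega> = of_nat n} = l ^ n / fact n * exp (- l)"
    and mono: "\<And>l m \<omega>. \<omega> \<in> space M \<Longrightarrow> 0 < l \<Longrightarrow> l \<le> m \<Longrightarrow> X l \<omega> \<le> X m \<omega>"
  shows "AE \<omega> in M. (\<forall>l>0. X l \<omega> < \<infinity>) \<and> ((\<lambda>l. enn2real (X l \<omega>) / l) \<longlongrightarrow> 1) at_top"
proof -
  \<comment> \<open>The shift to \<open>Suc n\<close> keeps every rate positive, as the hypotheses
    on \<open>X\<close> require; \<open>LIMSEQ_imp_Suc\<close> undoes it below.\<close>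
  define q where "q n = (real (Suc n))\<^sup>2" for n
  have q: "0 < q n" for n by (simp add: q_def)
  have [measurable]: "X (q n) \<in> borel_measurable M" for n by (simp add: q)
  have fin: "AE \<omega> in M. \<forall>n. X (q n) \<omega> < \<infinity>"
    unfolding AE_all_countable
  proof
    fix n show "AE \<omega> in M. X (q n) \<omega> < \<infinity>"
      using poisson_AE_nat[OF _ X[OF q[of n]]] q[of n]
      by (auto elim!: eventually_mono simp: of_nat_less_top)
  qed
  \<comment> \<open>Restricting the tolerance to \<open>inverse (real (Suc j))\<close> leaves
    countably many null sets, so one exceptional set serves for all tolerances.\<close>
  have dev: "AE \<omega> in M. \<forall>j. \<forall>\<^sub>F n in sequentially.
      \<omega> \<in> space M - {\<omega>\<in>space M. inverse (real (Suc j)) * q n \<le> \<bar>enn2real (X (q n) \<omega>) - q n\<bar>}"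
    unfolding AE_all_countable
  proof
    fix j :: nat
    define d where "d = inverse (real (Suc j))"
    have d: "0 < d" by (simp add: d_def)
    have "summable (\<lambda>n. prob {\<omega>\<in>space M. d * q n \<le> \<bar>enn2real (X (q n) \<omega>) - q n\<bar>})"
    proof (rule summable_comparison_test)
      have "prob {\<omega>\<in>space M. d * q n \<le> \<bar>enn2real (X (q n) \<omega>) - q n\<bar>} \<le> q n / (d * q n)\<^sup>2" for n
        using q d by (intro poisson_chebyshev X) auto
      also have "q n / (d * q n)\<^sup>2 = inverse (d\<^sup>2) * inverse ((real (Suc n))^2)" for n
        using q[of n] d by (simp add: q_def field_simps power2_eq_square del: of_nat_Suc)
      finally show "\<exists>N. \<forall>n\<ge>N. norm (prob {\<omega>\<in>space M. d * q n \<le> \<bar>enn2real (X (q n) \<omega>) - q n\<bar>})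
          \<le> inverse (d\<^sup>2) * inverse ((real (Suc n))^2)" by auto
      have "summable (\<lambda>n. inverse ((real n)^2))"
        by (rule inverse_power_summable) simp
      then show "summable (\<lambda>n. inverse (d\<^sup>2) * inverse ((real (Suc n))^2))"
        by (intro summable_mult) (subst summable_Suc_iff)
    qed
    then show "AE \<omega> in M. \<forall>\<^sub>F n in sequentially. \<omega> \<in> space M -
        {\<omega>\<in>space M. inverse (real (Suc j)) * q n \<le> \<bar>enn2real (X (q n) \<omega>) - q n\<bar>}"
      unfolding d_def by (intro borel_cantelli_AE1) (auto simp: emeasure_eq_measure)
  qed
  from fin dev AE_space show ?thesis
  proof eventually_elim
    case (elim \<omega>)
    have fin: "X l \<omega> < \<infinity>" if "0 < l" for l
    proof -
      obtain n where "l \<le> real n" using real_arch_simple by blast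
      also have "real n \<le> real (Suc n)" by simp
      also have "\<dots> \<le> q n" unfolding q_def by (rule self_le_power) auto
      finally have "X l \<omega> \<le> X (q n) \<omega>" using that elim(3) by (intro mono)
      with elim(1) show ?thesis by (meson order_le_less_trans)
    qed
    have "(\<lambda>n. enn2real (X (q n) \<omega>) / q n) \<longlonglongrightarrow> 1"
    proof (rule LIMSEQ_I)
      fix r :: real assume "0 < r"
      then obtain j where j: "inverse (real (Suc j)) < r" using reals_Archimedean by blast
      from elim(2)[rule_format, of j]
      have "\<forall>\<^sub>F n in sequentially. norm (enn2real (X (q n) \<omega>) / q n - 1) < r"
      proof eventually_elim
        case (elim n)
        then have "\<bar>enn2real (X (q n) \<omega>) - q n\<bar> < inverse (real (Suc j)) * q n" by auto
        also have "\<dots> < r * q n" using j q by simp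
        finally have "\<bar>enn2real (X (q n) \<omega>) - q n\<bar> / q n < r" using q[of n] by (simp add: field_simps)
        moreover have "enn2real (X (q n) \<omega>) / q n - 1 = (enn2real (X (q n) \<omega>) - q n) / q n"
          using q[of n] by (simp add: field_simps)
        ultimately show ?case using q[of n] by (simp add: abs_divide)
      qed
      then show "\<exists>no. \<forall>n\<ge>no. norm (enn2real (X (q n) \<omega>) / q n - 1) < r"
        by (simp add: eventually_sequentially)
    qed
    then have "(\<lambda>n. enn2real (X ((real n)\<^sup>2) \<omega>) / (real n)\<^sup>2) \<longlonglongrightarrow> 1"
      unfolding q_def by (rule LIMSEQ_imp_Suc)
    then have "((\<lambda>l. enn2real (X l \<omega>) / l) \<longlongrightarrow> 1) at_top"
      using elim(3) fin by (intro mono_ratio_tendsto_of_squares enn2real_mono mono) auto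
    with fin show ?case by blast
  qed
qed

section \<open>From counting asymptotics to sums of exponentials\<close>

lemma nn_integral_exp_minus_Ici:
  "(\<integral>\<^sup>+s. ennreal (exp (- s)) * indicator {a..} s \<partial>lborel) = ennreal (exp (- a))"
proof -
  have "((\<lambda>s::real. - exp (- s)) \<longlongrightarrow> - 0) at_top"
    by (intro tendsto_minus filterlim_compose[OF exp_at_bot filterlim_uminus_at_bot_at_top])
  then have "(\<integral>\<^sup>+s. ennreal (exp (- s)) * indicator {a..} s \<partial>lborel) = ennreal (- 0 - - exp (- a))"
    by (intro nn_integral_FTC_atLeast) (auto intro!: derivative_eq_intros)
  then show ?thesis by simp
qed

lemma suminf_indicator_eq_emeasure_count_space:
  "(\<Sum>k. indicator A k :: ennreal) = emeasure (count_space UNIV) A"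
  by (simp flip: nn_integral_count_space_nat)

text \<open>A deterministic Abelian statement. With \<open>g\<close> the normalised count and
  \<open>w\<close> the weight \<open>s powr \<alpha> * exp (- s)\<close> on the half-line, the
  quantity equals the integral of \<open>w s * g (u / s)\<close>. Here \<open>g\<close> is bounded
  and tends to 1 at 0, and \<open>w\<close> has integral
  \<open>Gamma (\<alpha> + 1) = \<alpha> * Gamma \<alpha>\<close>.\<close>

lemma exp_sum_asymptotics:
  fixes x :: "nat \<Rightarrow> real" and \<alpha> :: real
  assumes \<alpha>: "0 < \<alpha>" and x: "\<And>k. 0 < x k"
    and fin: "\<And>t. 0 < t \<Longrightarrow> finite {k. t < x k}"
    and lim: "((\<lambda>t. real (card {k. t < x k}) * t powr \<alpha>) \<longlongrightarrow> 1) (at_right 0)"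
  shows "((\<lambda>u. u powr \<alpha> * enn2real (\<Sum>k. ennreal (exp (- u / x k)))) \<longlongrightarrow> \<alpha> * Gamma \<alpha>) (at_right 0)"
proof -
  define g where "g t = real (card {k. t < x k}) * t powr \<alpha>" for t
  define w where "w s = indicator {0..} s * s powr \<alpha> / exp s" for s :: real
  have g0: "0 \<le> g t" for t by (simp add: g_def)
  have w0: "0 \<le> w s" for s by (simp add: w_def)
  \<comment> \<open>A series of indicators is visibly Borel in \<open>t\<close>. If infinitely many
    marks exceed \<open>t\<close>, both sides are 0, by the default values of \<open>card\<close>
    and of \<open>enn2real\<close> at infinity.\<close>
  have "real (card {k. t < x k}) = enn2real (\<Sum>k. indicator {..<x k} t)" for t
  proof -
    have "(\<Sum>k. indicator {..<x k} t :: ennreal) = (\<Sum>k. indicator {k. t < x k} k)"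
      by (intro suminf_cong) (auto split: split_indicator)
    then show ?thesis
      unfolding suminf_indicator_eq_emeasure_count_space
      by (cases "finite {k. t < x k}") (simp_all add: enn2real_top)
  qed
  then have [measurable]: "g \<in> borel_measurable borel" unfolding g_def by simp
  have [measurable]: "w \<in> borel_measurable borel" unfolding w_def by simp
  \<comment> \<open>Near 0 the limit bounds \<open>g\<close>. On \<open>[b, K]\<close> the count is
    at most its value at \<open>b\<close> and the power at most \<open>K powr \<alpha>\<close>.
    Beyond the largest mark \<open>g\<close> vanishes. Inserting \<open>b\<close> keeps
    \<open>Max\<close> meaningful when no mark exceeds \<open>b\<close>.\<close>
  obtain C where C: "g t \<le> C" if "0 < t" for t
  proof -
    have "\<forall>\<^sub>F t in at_right 0. g t < 2"
      using order_tendstoD(2)[OF lim, of 2] by (simp add: g_def)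
    then obtain b where b: "0 < b" "\<And>t. 0 < t \<Longrightarrow> t < b \<Longrightarrow> g t < 2"
      unfolding eventually_at_right_field by auto
    define K where "K = Max (insert b (x ` {k. b < x k}))"
    have K: "x k \<le> K" if "b < x k" for k
      unfolding K_def using fin[OF b(1)] that by (intro Max_ge) auto
    have "b \<le> K" unfolding K_def using fin[OF b(1)] by (intro Max_ge) auto
    have "g t \<le> max 2 (real (card {k. b < x k}) * K powr \<alpha>)" if "0 < t" for t
    proof -
      consider "t < b" | "b \<le> t" "t \<le> K" | "b \<le> t" "K < t" by linarith
      then show ?thesis
      proof cases
        case 1 with b(2)[OF that] show ?thesis by fastforce
      next
        case 2
        then have "g t \<le> real (card {k. b < x k}) * K powr \<alpha>"
          unfolding g_def using fin[OF b(1)] \<alpha> that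
          by (intro mult_mono powr_mono2 of_nat_mono card_mono) auto
        then show ?thesis by simp
      next
        case 3
        have "\<not> t < x k" for k using K[of k] 3 by linarith
          then have e: "{k. t < x k} = {}" by simp
        show ?thesis by (simp add: g_def e)
      qed
    qed
    then show ?thesis by (rule that)
  qed
  have wint: "(\<integral>\<^sup>+s. ennreal (w s) \<partial>lborel) = ennreal (\<alpha> * Gamma \<alpha>)"
  proof -
    have "\<alpha> \<notin> \<int>\<^sub>\<le>\<^sub>0" using \<alpha> by (auto elim!: nonpos_Ints_cases)
    with Gamma_conv_nn_integral_real[of "\<alpha> + 1"] Gamma_plus1[of \<alpha>] \<alpha>
    show ?thesis by (simp add: w_def)
  qed
  have key: "(\<integral>\<^sup>+s. ennreal (w s * g (u / s)) \<partial>lborel)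
      = ennreal (u powr \<alpha>) * (\<Sum>k. ennreal (exp (- u / x k)))" if u: "0 < u" for u
  proof -
    have "(\<Sum>k. ennreal (exp (- u / x k)))
        = (\<Sum>k. \<integral>\<^sup>+s. ennreal (exp (- s)) * indicator {u / x k..} s \<partial>lborel)"
      by (simp add: nn_integral_exp_minus_Ici)
    also have "\<dots> = (\<integral>\<^sup>+s. (\<Sum>k. ennreal (exp (- s)) * indicator {u / x k..} s) \<partial>lborel)"
      by (rule nn_integral_suminf[symmetric]) simp
    finally have "ennreal (u powr \<alpha>) * (\<Sum>k. ennreal (exp (- u / x k)))
        = (\<integral>\<^sup>+s. ennreal (u powr \<alpha>) * (\<Sum>k. ennreal (exp (- s)) * indicator {u / x k..} s) \<partial>lborel)"
      by (simp add: nn_integral_cmult)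
    also have "\<dots> = (\<integral>\<^sup>+s. ennreal (w s * g (u / s)) \<partial>lborel)"
    proof (rule nn_integral_cong_AE)
      \<comment> \<open>The closed ray \<open>{u / x k..}\<close> and the strict condition
        \<open>u / s < x k\<close> disagree only at \<open>s = u / x k\<close>, a countable set of
        exceptions.\<close>
      have "AE s in lborel. \<forall>k. s \<noteq> u / x k"
        unfolding AE_all_countable by (intro allI AE_lborel_singleton)
      then show "AE s in lborel. ennreal (u powr \<alpha>) *
          (\<Sum>k. ennreal (exp (- s)) * indicator {u / x k..} s) = ennreal (w s * g (u / s))"
      proof eventually_elim
        case (elim s)
        show ?case
        proof (cases "0 < s")
          case True
          have "(indicator {u / x k..} s :: ennreal) = indicator {k. u / s < x k} k" for k
            using elim[rule_format, of k] x[of k] True u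
            by (auto split: split_indicator simp: field_simps)
          then have "(\<Sum>k. ennreal (exp (- s)) * indicator {u / x k..} s)
              = ennreal (exp (- s)) * emeasure (count_space UNIV) {k. u / s < x k}"
            by (simp add: suminf_indicator_eq_emeasure_count_space)
          also have "\<dots> = ennreal (exp (- s) * real (card {k. u / s < x k}))"
            using fin[of "u / s"] u True by (simp add: ennreal_mult' ennreal_of_nat_eq_real_of_nat)
          \<comment> \<open>The identity
            \<open>u powr \<alpha> = s powr \<alpha> * (u / s) powr \<alpha>\<close> splits the
            prefactor between \<open>w s\<close> and \<open>g (u / s)\<close>.\<close>
          finally show ?thesis using True u
            by (simp add: w_def g_def ennreal_mult'[symmetric] exp_minus powr_divide field_simps)
        next
          \<comment> \<open>Each \<open>u / x k\<close> is positive, so all indicators vanish;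
            \<open>w\<close> also vanishes at \<open>s = 0\<close>, because
            \<open>0 powr \<alpha> = 0\<close>.\<close>
          case False
          moreover have "indicator {u / x k..} s = (0 :: ennreal)" for k
            using False u divide_pos_pos[OF u x[of k]] by (auto split: split_indicator)
          moreover have "w s = 0" using False by (auto simp: w_def split: split_indicator)
          ultimately show ?thesis by simp
        qed
      qed
    qed
    finally show ?thesis by simp
  qed
  show ?thesis
  \<comment> \<open>Dominated convergence is applied along sequences; 1 is an arbitrary right
    endpoint.\<close>
  proof (rule tendsto_at_right_sequentially[of _ 1])
    fix S :: "nat \<Rightarrow> real"
    assume S: "\<And>n. 0 < S n" "S \<longlonglongrightarrow> 0"
    have "(\<lambda>n. \<integral>s. w s * g (S n / s) \<partial>lborel) \<longlonglongrightarrow> (\<integral>s. w s \<partial>lborel)"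
    proof (rule integral_dominated_convergence[where w = "\<lambda>s. w s * C"])
      show "integrable lborel (\<lambda>s. w s * C)"
        using wint w0 by (intro integrable_mult_left integrableI_nonneg) auto
      show "AE s in lborel. (\<lambda>n. w s * g (S n / s)) \<longlonglongrightarrow> w s"
      proof (rule AE_I2)
        fix s :: real
        show "(\<lambda>n. w s * g (S n / s)) \<longlonglongrightarrow> w s"
        proof (cases "0 < s")
          case True
          have "filterlim (\<lambda>n. S n / s) (at_right 0) sequentially"
            using True S by (auto simp: filterlim_at less_imp_neq[symmetric] intro!: tendsto_eq_intros)
          from filterlim_compose[OF lim this] have "(\<lambda>n. g (S n / s)) \<longlonglongrightarrow> 1"
            by (simp add: g_def)
          then show ?thesis by (auto intro!: tendsto_eq_intros)
        next
          case False
          then have "w s = 0" using \<alpha> by (auto simp: w_def split: split_indicator)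
          then show ?thesis by simp
        qed
      qed
      show "AE s in lborel. norm (w s * g (S n / s)) \<le> w s * C" for n
      proof (rule AE_I2)
        fix s :: real
        show "norm (w s * g (S n / s)) \<le> w s * C"
        proof (cases "0 < s")
          case True
          then show ?thesis using C[of "S n / s"] S(1)[of n] w0 g0
            by (simp add: abs_mult mult_left_mono)
        next
          case False
          then have "w s = 0" using \<alpha> by (auto simp: w_def split: split_indicator)
          then show ?thesis by simp
        qed
      qed
    qed auto
    moreover have "(\<integral>s. w s \<partial>lborel) = \<alpha> * Gamma \<alpha>"
      using w0 \<alpha> by (simp add: integral_eq_nn_integral wint Gamma_real_pos less_imp_le)
    \<comment> \<open>The integral is finite by the domination with \<open>C\<close>, so
      \<open>key\<close> makes the series finite too and \<open>enn2real\<close> gives its true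
      value.\<close>
    moreover have "(\<integral>s. w s * g (S n / s) \<partial>lborel)
        = S n powr \<alpha> * enn2real (\<Sum>k. ennreal (exp (- S n / x k)))" for n
      using w0 g0 by (simp add: integral_eq_nn_integral key S enn2real_mult)
    ultimately show "(\<lambda>n. S n powr \<alpha> * enn2real (\<Sum>k. ennreal (exp (- S n / x k))))
        \<longlonglongrightarrow> \<alpha> * Gamma \<alpha>" by simp
  qed simp
qed

section \<open>Application to the Poisson marks\<close>

text \<open>Positivity of the points makes \<open>x\<close> measurable into
  \<open>pos_borel\<close>, so \<open>distr\<close> is a genuine push-forward of counting
  measure.\<close>

lemma emeasure_point_process_pos_borel:
  assumes "\<And>k. 0 < x k" "0 \<le> t"
  shows "emeasure (point_process pos_borel x) {t<..} = emeasure (count_space UNIV) {k. t < x k}"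
proof -
  have "x \<in> measurable (count_space UNIV) pos_borel"
    using assms by (auto simp: pos_borel_def space_restrict_space)
  moreover have "{t<..} \<in> sets pos_borel"
    using assms by (auto simp: pos_borel_def sets_restrict_space_iff)
  ultimately show ?thesis
    by (simp add: point_process_def emeasure_distr vimage_def)
qed

theorem lemma1p11:
  fixes P :: "'a measure"
    and \<beta> \<alpha> \<epsilon> :: real
    and \<mu> :: "real measure"
    and \<gamma> :: "nat \<Rightarrow> 'a \<Rightarrow> real"
    and \<nu> :: "'a \<Rightarrow> real measure"
  assumes "prob_space P"
    and "\<alpha> = beta_c / \<beta>"
    and "0 < \<epsilon>"
    and "sets \<mu> = sets pos_borel"
    and "\<And>x. 0 < x \<Longrightarrow> emeasure \<mu> {x<..} = ennreal (x powr (- \<alpha>))"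
    and "\<And>k \<omega>. \<omega> \<in> space P \<Longrightarrow> 0 < \<gamma> k \<omega>"
    and "poisson_random_measure P \<mu> (\<lambda>\<omega>. point_process pos_borel (\<lambda>k. \<gamma> k \<omega>))"
    and "random_measure P pos_borel \<nu>"
    and "\<And>u \<omega>. 0 < u \<Longrightarrow> \<omega> \<in> space P \<Longrightarrow>
           emeasure (\<nu> \<omega>) {u<..} = ennreal \<epsilon> * (\<Sum>k. ennreal (exp (- u / \<gamma> k \<omega>)))"
    and "\<beta> > beta_c"
  shows "AE \<omega> in P. (\<lambda>u. measure (\<nu> \<omega>) {u<..}) \<sim>[at_right 0]
           (\<lambda>u. \<epsilon> * u powr (- \<alpha>) * \<alpha> * Gamma \<alpha>)"
proof -
  interpret prob_space P by fact
  \<comment> \<open>Since \<open>\<beta> > beta_c > 0\<close>, both \<open>\<beta>\<close> and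
    \<open>\<alpha>\<close> are positive.\<close>
  have "0 < beta_c" by (simp add: beta_c_def)
  then have \<alpha>: "0 < \<alpha>" using assms(2,10) by simp
  \<comment> \<open>\<open>r\<close> inverts the tail \<open>x powr (- \<alpha>)\<close>: the marks
    above \<open>r l\<close> have mean number exactly \<open>l\<close>, which indexes the counts by
    their rate as the strong law expects.\<close>
  define r where "r l = l powr (- (1 / \<alpha>))" for l :: real
  have r: "0 < r l" "r l powr (- \<alpha>) = l" if "0 < l" for l :: real
    using that \<alpha> by (simp_all add: r_def powr_powr)
  have r_anti: "r m \<le> r l" if "0 < l" "l \<le> m" for l m :: real
    unfolding r_def using that \<alpha> by (intro powr_mono2') auto
  define X where "X l \<omega> = emeasure (point_process pos_borel (\<lambda>k. \<gamma> k \<omega>)) {r l<..}" for l \<omega>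
  have X: "X l \<omega> = emeasure (count_space UNIV) {k. r l < \<gamma> k \<omega>}" if "\<omega> \<in> space P" for l :: real and \<omega>
    using that assms(6) unfolding X_def
    by (intro emeasure_point_process_pos_borel) (auto simp: r_def)
  have sets: "{r l<..} \<in> sets \<mu>" for l :: real
    by (auto simp: assms(4) pos_borel_def sets_restrict_space_iff r_def intro: le_less_trans)
  from assms(7) have meas: "(\<lambda>\<omega>. emeasure (point_process pos_borel (\<lambda>k. \<gamma> k \<omega>)) A) \<in> borel_measurable P"
    if "A \<in> sets \<mu>" for A
    using that by (simp add: poisson_random_measure_def random_measure_def)
  from assms(7) have law: "prob {\<omega>\<in>space P. emeasure (point_process pos_borel (\<lambda>k. \<gamma> k \<omega>)) A = of_nat n}
      = measure \<mu> A ^ n / fact n * exp (- measure \<mu> A)"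
    if "A \<in> sets \<mu>" "emeasure \<mu> A < \<infinity>" for A n
    using that by (simp add: poisson_random_measure_def)
  have "AE \<omega> in P. (\<forall>l>0. X l \<omega> < \<infinity>) \<and> ((\<lambda>l. enn2real (X l \<omega>) / l) \<longlongrightarrow> 1) at_top"
  proof (rule poisson_mono_family_strong_law)
    fix l :: real assume l: "0 < l"
    show "X l \<in> borel_measurable P"
      unfolding X_def by (rule meas[OF sets])
    fix n
    have "emeasure \<mu> {r l<..} = ennreal l" using assms(5)[OF r(1)[OF l]] r(2)[OF l] by simp
    moreover from this have "measure \<mu> {r l<..} = l" using l by (simp add: measure_def)
    ultimately show "prob {\<omega>\<in>space P. X l \<omega> = of_nat n} = l ^ n / fact n * exp (- l)"
      using law[OF sets, of l n] unfolding X_def by simp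
  next
    fix l m :: real and \<omega> assume "\<omega> \<in> space P" "0 < l" "l \<le> m"
    then show "X l \<omega> \<le> X m \<omega>"
      using r_anti[of l m] by (auto simp: X intro!: emeasure_mono)
  qed
  then show ?thesis using AE_space
  proof eventually_elim
    case (elim \<omega>)
    have rr: "r (t powr (- \<alpha>)) = t" if "0 < t" for t
      using that \<alpha> by (simp add: r_def powr_powr)
    \<comment> \<open>Counting measure is infinite on infinite sets, so finiteness of
      \<open>X\<close> at the rate \<open>t powr (- \<alpha>)\<close> forces finitely many marks
      above \<open>t\<close>.\<close>
    have fin: "finite {k. t < \<gamma> k \<omega>}" if "0 < t" for t
    proof -
      have "X (t powr (- \<alpha>)) \<omega> < \<infinity>" using elim that by simp
      then show ?thesis using X[OF elim(2), of "t powr (- \<alpha>)"] rr[OF that]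
        by (auto simp: emeasure_count_space split: if_splits)
    qed
    \<comment> \<open>Thresholds tending to 0 correspond to rates tending to infinity, which turns
      the strong law into the counting hypothesis of \<open>exp_sum_asymptotics\<close>.\<close>
    have "filterlim (\<lambda>t::real. t powr (- \<alpha>)) at_top (at_right 0)"
      using \<alpha> by real_asymp
    with elim have "((\<lambda>t. enn2real (X (t powr (- \<alpha>)) \<omega>) / (t powr (- \<alpha>))) \<longlongrightarrow> 1) (at_right 0)"
      by (auto intro: filterlim_compose)
    moreover have "\<forall>\<^sub>F t in at_right 0. enn2real (X (t powr (- \<alpha>)) \<omega>) / (t powr (- \<alpha>))
        = real (card {k. t < \<gamma> k \<omega>}) * t powr \<alpha>"
      using eventually_at_right_less[of 0]
    proof eventually_elim
      case (elim t)
      have "enn2real (X (t powr (- \<alpha>)) \<omega>) = real (card {k. t < \<gamma> k \<omega>})"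
        using X[OF \<open>\<omega> \<in> space P\<close>] rr[OF elim] fin[OF elim] by simp
      then show ?case by (simp add: powr_minus field_simps)
    qed
    ultimately have count: "((\<lambda>t. real (card {k. t < \<gamma> k \<omega>}) * t powr \<alpha>) \<longlongrightarrow> 1) (at_right 0)"
      by (rule Lim_transform_eventually)
    have gpos: "0 < \<alpha> * Gamma \<alpha>"
      using \<alpha> by (simp add: Gamma_real_pos)
    define f where "f u = u powr \<alpha> * enn2real (\<Sum>k. ennreal (exp (- u / \<gamma> k \<omega>)))" for u
    have "(f \<longlongrightarrow> \<alpha> * Gamma \<alpha>) (at_right 0)"
      unfolding f_def by (rule exp_sum_asymptotics[OF \<alpha> assms(6)[OF elim(2)] fin count])
    then have "((\<lambda>u. f u / (\<alpha> * Gamma \<alpha>)) \<longlongrightarrow> \<alpha> * Gamma \<alpha> / (\<alpha> * Gamma \<alpha>)) (at_right 0)"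
      using less_imp_neq[OF gpos] by (intro tendsto_divide tendsto_const) auto
    moreover have "\<alpha> * Gamma \<alpha> / (\<alpha> * Gamma \<alpha>) = 1"
      by (rule divide_self) (rule less_imp_neq[OF gpos, symmetric])
    ultimately have "((\<lambda>u. f u / (\<alpha> * Gamma \<alpha>)) \<longlongrightarrow> 1) (at_right 0)"
      by (rule subst[rotated])
    \<comment> \<open>The quotient that defines asymptotic equivalence: the factor
      \<open>\<epsilon>\<close> cancels and \<open>u powr (- \<alpha>)\<close> moves to the
      numerator.\<close>
    moreover have "\<forall>\<^sub>F u in at_right 0.
        f u / (\<alpha> * Gamma \<alpha>) = measure (\<nu> \<omega>) {u<..} / (\<epsilon> * u powr (- \<alpha>) * \<alpha> * Gamma \<alpha>)"
      using eventually_at_right_less[of 0]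
    proof eventually_elim
      case (elim u)
      then have "measure (\<nu> \<omega>) {u<..} = \<epsilon> * enn2real (\<Sum>k. ennreal (exp (- u / \<gamma> k \<omega>)))"
        using assms(3,9) \<open>\<omega> \<in> space P\<close> by (simp add: measure_def enn2real_mult)
      then show ?case using assms(3) \<open>0 < u\<close> by (simp add: f_def powr_minus field_simps)
    qed
    ultimately show ?case
      by (intro asymp_equivI') (rule Lim_transform_eventually)
  qed
qed

end
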